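(* Let $H,A,b$ and the resolvent family $\{S(t)\}_{t\ge 0}$ be as in the context; in particular, $A$ is self-adjoint and positive definite with compact inverse, $b$ is a positive definite kernel, and $\{S(t)\}_{t\ge0}$ satisfies the smoothing assumption stated there. Let $T>0$, $u_0\in H$, $f:[0,T]\to H$, and let $u$ be the solution of the linear problem $$u'(t)+\int_0^t b(t-s)Au(s)\,ds=f(t),\quad t\in(0,T],\qquad u(0)=u_0,$$ given by the variation-of-constants formula $u(t)=S(t)u_0+\int_0^t S(t-\sigma)f(\sigma)\,d\sigma$. Let $p\ge 1$, and consider an exponential quadrature rule (exponential Runge--Kutta method) $$U_m=S(t_m)u_0+h\sum_{j=0}^{m-1}\sum_{i=1}^{s}b_i(t_{m-j})f(t_j+c_ih),\qquad 0\le m\le M,$$ of order $p$ in the sense defined in the context. If $f^{(p)}\in L^1(0,T;H)$, then $$\|u(t_m)-U_m\|\le C\,h^p\int_{t_0}^{t_m}\|f^{(p)}(\tau)\|\,d\tau$$ uniformly on $0\le t_m\le T$. The constant $C$ depends on the final time $T$, but is independent of $m$ and $h$.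
   Context: Setting. $H$ is a real, separable, infinite-dimensional Hilbert space with inner product $(\cdot,\cdot)$ and norm $\|\cdot\|$; $\mathcal{B}$ denotes the bounded linear operators on $H$ with operator norm $\|\cdot\|_{\mathcal B}$. $A$ is a self-adjoint, positive definite operator on $H$ with compact inverse, with orthonormal eigenbasis $\{\psi_k\}_{k\ge1}$ and eigenvalues $0<\lambda_1\le\lambda_2\le\cdots$, $\lambda_k\to\infty$, $A\psi_k=\lambda_k\psi_k$; fractional powers $A^\alpha$ are defined spectrally. The kernel $b$ is real-valued and positive definite: for each $T>0$, $b\in L^1(0,T)$ and $\int_0^T\psi(t)\int_0^t b(t-s)\psi(s)\,ds\,dt\ge0$ for all $\psi\in C[0,T]$. Resolvent family. $\{S(t)\}_{t\ge0}$ is the strongly continuous family of bounded linear operators on $H$ such that $u(t)=S(t)u_0$ is the unique solution of $u(t)+A\int_0^tB(t-s)u(s)\,ds=u_0$, $t\ge0$, with $B(t)=\int_0^tb(s)\,ds$. Explicitly $S(t)v=\sum_{k\ge1}s_k(t)(v,\psi_k)\psi_k$, where $s_k'(t)+\lambda_k\int_0^tb(t-s)s_k(s)\,ds=0$ for $t>0$, $s_k(0)=1$. Smoothing assumption. $\{S(t)\}$ is strongly continuous for $t\ge0$ and strongly continuously differentiable for $t>0$, and there are constants $C$ and $1<\rho<2$ such that for all $0<t\le T$, $\|A^\alpha S(t)\|_{\mathcal B}\le Ct^{-\alpha\rho}$ for $0\le\alpha<1/\rho$. Time grid. $0=t_0<t_1<\dots<t_M=T$ is a uniform partition with step size $h=t_{m+1}-t_m$,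 so $t_m=mh$. Exponential quadrature rule. The nodes satisfy $0=c_1<c_2<\cdots<c_s\le1$. For $1\le i\le s$ and $1\le l\le M$ the weights $b_i(t_l)$ are bounded operators on $H$ (which may depend on $h$), with a bound uniform in the step size $h$ (and in $l$). For $k\ge1$ set $$\varphi_{k,h}(t_l)=\frac1{h^k}\int_0^hS(t_l-\sigma)\frac{\sigma^{k-1}}{(k-1)!}\,d\sigma .$$ The method has order $p$ if $\sum_{i=1}^sb_i(t_l)\frac{c_i^{k-1}}{(k-1)!}=\varphi_{k,h}(t_l)$ for all $k=1,\dots,p$ and all $1\le l\le M$. *)

theory Defs
  imports "HOL-Analysis.Analysis"
begin

text \<open>
  All integrals are Lebesgue (Bochner) integrals. A separable real Hilbert space is a type of sort
  \<open>{real_inner, banach, second_countable_topology}\<close>: for metric spaces, separable and second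
  countable coincide.
\<close>

subsection \<open>The operator\<close>

definition linear_on_domain :: "'a::real_vector set \<Rightarrow> ('a \<Rightarrow> 'a) \<Rightarrow> bool" where
  "linear_on_domain D A \<longleftrightarrow> subspace D \<and>
     (\<forall>x\<in>D. \<forall>y\<in>D. A (x + y) = A x + A y) \<and> (\<forall>r. \<forall>x\<in>D. A (r *\<^sub>R x) = r *\<^sub>R A x)"

text \<open>The last conjunct says that the graphs of \<open>A\<close> and of its Hilbert space adjoint coincide,
  domains included. Values of \<open>A\<close> outside \<open>D\<close> are irrelevant.\<close>

definition self_adjoint_op :: "'a::real_inner set \<Rightarrow> ('a \<Rightarrow> 'a) \<Rightarrow> bool" where
  "self_adjoint_op D A \<longleftrightarrow> linear_on_domain D A \<and> closure D = UNIV \<and>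
     (\<forall>w z. (\<forall>v\<in>D. A v \<bullet> w = v \<bullet> z) \<longleftrightarrow> w \<in> D \<and> A w = z)"

definition positive_definite_op :: "'a::real_inner set \<Rightarrow> ('a \<Rightarrow> 'a) \<Rightarrow> bool" where
  "positive_definite_op D A \<longleftrightarrow> (\<forall>v\<in>D. v \<noteq> 0 \<longrightarrow> A v \<bullet> v > 0)"

definition compact_linear_op :: "('a::real_normed_vector \<Rightarrow> 'a) \<Rightarrow> bool" where
  "compact_linear_op L \<longleftrightarrow> bounded_linear L \<and> compact (closure (L ` cball 0 1))"

definition has_compact_inverse :: "'a::real_normed_vector set \<Rightarrow> ('a \<Rightarrow> 'a) \<Rightarrow> bool" where
  "has_compact_inverse D A \<longleftrightarrow> bij_betw A D UNIV \<and> compact_linear_op (the_inv_into D A)"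

text \<open>Indices start at 0 here. A basis indexed by \<open>nat\<close> makes the space infinite-dimensional.\<close>

definition orthonormal_basis :: "(nat \<Rightarrow> 'a::real_inner) \<Rightarrow> bool" where
  "orthonormal_basis \<psi> \<longleftrightarrow>
     (\<forall>i j. \<psi> i \<bullet> \<psi> j = (if i = j then 1 else 0)) \<and> closure (span (range \<psi>)) = UNIV"

definition eigenbasis ::
    "'a::real_inner set \<Rightarrow> ('a \<Rightarrow> 'a) \<Rightarrow> (nat \<Rightarrow> 'a) \<Rightarrow> (nat \<Rightarrow> real) \<Rightarrow> bool" where
  "eigenbasis D A \<psi> ev \<longleftrightarrow> orthonormal_basis \<psi> \<and>
     (\<forall>k. \<psi> k \<in> D \<and> A (\<psi> k) = ev k *\<^sub>R \<psi> k) \<and>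
     0 < ev 0 \<and> mono ev \<and> filterlim ev at_top sequentially"

definition frac_pow_domain ::
    "(nat \<Rightarrow> 'a::real_inner) \<Rightarrow> (nat \<Rightarrow> real) \<Rightarrow> real \<Rightarrow> 'a set" where
  "frac_pow_domain \<psi> ev \<alpha> = {v. summable (\<lambda>k. (ev k powr \<alpha> * (v \<bullet> \<psi> k))\<^sup>2)}"

definition frac_pow ::
    "(nat \<Rightarrow> 'a::real_inner) \<Rightarrow> (nat \<Rightarrow> real) \<Rightarrow> real \<Rightarrow> 'a \<Rightarrow> 'a" where
  "frac_pow \<psi> ev \<alpha> v = (\<Sum>k. (ev k powr \<alpha> * (v \<bullet> \<psi> k)) *\<^sub>R \<psi> k)"

subsection \<open>The kernel and the resolvent family\<close>

definition positive_definite_kernel :: "(real \<Rightarrow> real) \<Rightarrow> bool" where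
  "positive_definite_kernel b \<longleftrightarrow> (\<forall>T>0. set_integrable lebesgue {0<..<T} b \<and>
     (\<forall>\<phi>. continuous_on {0..T} \<phi> \<longrightarrow>
        0 \<le> (LINT t:{0..T}|lebesgue. \<phi> t * (LINT s:{0..t}|lebesgue. b (t - s) * \<phi> s))))"

definition kernel_primitive :: "(real \<Rightarrow> real) \<Rightarrow> real \<Rightarrow> real" where
  "kernel_primitive b t = (LINT s:{0..t}|lebesgue. b s)"

definition volterra_solution ::
    "'a::{real_inner,banach,second_countable_topology} set \<Rightarrow> ('a \<Rightarrow> 'a) \<Rightarrow> (real \<Rightarrow> real) \<Rightarrow>
     'a \<Rightarrow> (real \<Rightarrow> 'a) \<Rightarrow> bool" where
  "volterra_solution D A b u0 u \<longleftrightarrow> continuous_on {0..} u \<and>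
     (\<forall>t\<ge>0. (LINT s:{0..t}|lebesgue. kernel_primitive b (t - s) *\<^sub>R u s) \<in> D \<and>
        u t + A (LINT s:{0..t}|lebesgue. kernel_primitive b (t - s) *\<^sub>R u s) = u0)"

definition resolvent_family ::
    "'a::{real_inner,banach,second_countable_topology} set \<Rightarrow> ('a \<Rightarrow> 'a) \<Rightarrow> (real \<Rightarrow> real) \<Rightarrow>
     (real \<Rightarrow> 'a \<Rightarrow>\<^sub>L 'a) \<Rightarrow> bool" where
  "resolvent_family D A b S \<longleftrightarrow>
     (\<forall>v. continuous_on {0..} (\<lambda>t. S t v)) \<and>
     (\<forall>u0. volterra_solution D A b u0 (\<lambda>t. S t u0) \<and>
        (\<forall>u. volterra_solution D A b u0 u \<longrightarrow> (\<forall>t\<ge>0. u t = S t u0)))"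

text \<open>The norm bound on \<open>A\<^sup>\<alpha> S(t)\<close> includes that \<open>S(t)\<close> maps into the domain of \<open>A\<^sup>\<alpha>\<close> and that
  the composition is bounded (\<^const>\<open>onorm\<close> is meaningless otherwise).\<close>

definition smoothing_assumption ::
    "(nat \<Rightarrow> 'a::{real_inner,banach}) \<Rightarrow> (nat \<Rightarrow> real) \<Rightarrow> real \<Rightarrow> (real \<Rightarrow> 'a \<Rightarrow>\<^sub>L 'a) \<Rightarrow> bool" where
  "smoothing_assumption \<psi> ev T S \<longleftrightarrow>
     (\<forall>v. continuous_on {0..} (\<lambda>t. S t v)) \<and>
     (\<forall>v. \<exists>d. continuous_on {0<..} d \<and>
        (\<forall>t>0. ((\<lambda>r. S r v) has_vector_derivative d t) (at t))) \<and>
     (\<exists>C \<rho>. 1 < \<rho> \<and> \<rho> < 2 \<and>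
        (\<forall>t \<alpha>. 0 < t \<and> t \<le> T \<and> 0 \<le> \<alpha> \<and> \<alpha> < 1 / \<rho> \<longrightarrow>
           range (blinfun_apply (S t)) \<subseteq> frac_pow_domain \<psi> ev \<alpha> \<and>
           bounded_linear (\<lambda>v. frac_pow \<psi> ev \<alpha> (S t v)) \<and>
           onorm (\<lambda>v. frac_pow \<psi> ev \<alpha> (S t v)) \<le> C * t powr (- \<alpha> * \<rho>)))"

subsection \<open>The linear problem\<close>

text \<open>The solution of \<open>u'(t) + \<integral>\<^sub>0\<^sup>t b(t-s) A u(s) ds = f(t)\<close>, \<open>u(0) = u0\<close> is understood as the one
  given by the variation-of-constants formula.\<close>

definition voc_solution ::
    "(real \<Rightarrow> 'a \<Rightarrow>\<^sub>L 'a) \<Rightarrow> 'a \<Rightarrow> (real \<Rightarrow> 'a::{real_inner,banach,second_countable_topology}) \<Rightarrow>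
     real \<Rightarrow> 'a" where
  "voc_solution S u0 f t = S t u0 + (LINT \<sigma>:{0..t}|lebesgue. S (t - \<sigma>) (f \<sigma>))"

text \<open>\<open>F k\<close> is the \<open>k\<close>-th derivative of \<open>f\<close> on \<open>[0,T]\<close>, and \<open>F p\<close> is in \<open>L\<^sup>1(0,T;H)\<close>; in other words
  \<open>f\<close> is (the continuous representative of) an element of \<open>W\<^sup>p\<^sup>,\<^sup>1(0,T;H)\<close>. For \<open>k < p\<close> the integral
  identity makes \<open>F k\<close> absolutely continuous with a.e. derivative \<open>F (Suc k)\<close>, so that
  \<open>F 0, \<dots>, F (p - 1)\<close> are classical derivatives and only \<open>F p\<close> is determined merely a.e.\<close>

definition L1_derivatives ::
    "real \<Rightarrow> nat \<Rightarrow> (real \<Rightarrow> 'a::{banach,second_countable_topology}) \<Rightarrow> (nat \<Rightarrow> real \<Rightarrow> 'a) \<Rightarrow> bool"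
  where
  "L1_derivatives T p f F \<longleftrightarrow>
     (\<forall>t\<in>{0..T}. F 0 t = f t) \<and>
     (\<forall>k<p. set_integrable lebesgue {0..T} (F (Suc k)) \<and>
        (\<forall>t\<in>{0..T}. F k t = F k 0 + (LINT \<tau>:{0..t}|lebesgue. F (Suc k) \<tau>)))"

subsection \<open>Exponential quadrature\<close>

definition quadrature_nodes :: "nat \<Rightarrow> (nat \<Rightarrow> real) \<Rightarrow> bool" where
  "quadrature_nodes s c \<longleftrightarrow> 1 \<le> s \<and> c 1 = 0 \<and> strict_mono_on {1..s} c \<and> c s \<le> 1"

text \<open>The integral of the operator-valued function is taken strongly, i.e. applied to a vector.\<close>

definition phi ::
    "(real \<Rightarrow> 'a \<Rightarrow>\<^sub>L 'a) \<Rightarrow> nat \<Rightarrow> real \<Rightarrow> real \<Rightarrow>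
     'a::{real_inner,banach,second_countable_topology} \<Rightarrow> 'a" where
  "phi S k h t v =
     (1 / h ^ k) *\<^sub>R (LINT \<sigma>:{0..h}|lebesgue. (\<sigma> ^ (k - 1) / fact (k - 1)) *\<^sub>R S (t - \<sigma>) v)"

text \<open>A method is a family of weights over all step sizes \<open>h = T / M\<close>; \<open>w h i t\<^sub>l\<close> is the weight
  \<open>b\<^sub>i(t\<^sub>l)\<close> used with step size \<open>h\<close>.\<close>

definition weights_uniformly_bounded ::
    "real \<Rightarrow> nat \<Rightarrow> (real \<Rightarrow> nat \<Rightarrow> real \<Rightarrow> 'a::real_normed_vector \<Rightarrow>\<^sub>L 'a) \<Rightarrow> bool" where
  "weights_uniformly_bounded T s w \<longleftrightarrow>
     (\<exists>K. \<forall>M\<ge>1. \<forall>i\<in>{1..s}. \<forall>l\<in>{1..M}.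
        norm (w (T / real M) i (real l * (T / real M))) \<le> K)"

definition has_order ::
    "(real \<Rightarrow> 'a \<Rightarrow>\<^sub>L 'a::{real_inner,banach,second_countable_topology}) \<Rightarrow> real \<Rightarrow> nat \<Rightarrow>
     (nat \<Rightarrow> real) \<Rightarrow> (real \<Rightarrow> nat \<Rightarrow> real \<Rightarrow> 'a \<Rightarrow>\<^sub>L 'a) \<Rightarrow> nat \<Rightarrow> bool" where
  "has_order S T s c w p \<longleftrightarrow>
     (\<forall>M\<ge>1. \<forall>k\<in>{1..p}. \<forall>l\<in>{1..M}. \<forall>v. let h = T / real M; t = real l * h in
        (\<Sum>i=1..s. (c i ^ (k - 1) / fact (k - 1)) *\<^sub>R w h i t v) = phi S k h t v)"

definition exp_quadrature ::
    "(real \<Rightarrow> 'a \<Rightarrow>\<^sub>L 'a::real_normed_vector) \<Rightarrow> nat \<Rightarrow> (nat \<Rightarrow> real) \<Rightarrow>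
     (real \<Rightarrow> nat \<Rightarrow> real \<Rightarrow> 'a \<Rightarrow>\<^sub>L 'a) \<Rightarrow> 'a \<Rightarrow> (real \<Rightarrow> 'a) \<Rightarrow> real \<Rightarrow> nat \<Rightarrow> 'a" where
  "exp_quadrature S s c w u0 f h m =
     S (real m * h) u0 +
     h *\<^sub>R (\<Sum>j<m. \<Sum>i=1..s. w h i (real (m - j) * h) (f (real j * h + c i * h)))"

end

theory Submission
  imports Defs
begin

text \<open>
  Both the exact solution and the scheme split over the grid intervals, so it suffices to compare, on
  the interval starting at \<open>a = t\<^sub>j\<close>, the convolution \<open>\<integral>\<^sub>0\<^sup>h S(t\<^sub>m\<^sub>-\<^sub>j - \<sigma>) f(a + \<sigma>) d\<sigma>\<close> with its quadrature
  \<open>h \<Sum>\<^sub>i b\<^sub>i(t\<^sub>m\<^sub>-\<^sub>j) f(a + c\<^sub>i h)\<close>. Expand \<open>f\<close> around \<open>a\<close> into its Taylor polynomial of degree \<open>p - 1\<close>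
  plus a remainder. The order conditions say exactly that the quadrature integrates operator-weighted
  polynomials of degree below \<open>p\<close> without error (\<open>\<phi>\<^sub>k\<^sub>,\<^sub>h\<close> is the scaled convolution of \<open>S\<close> with
  \<open>\<sigma>\<^sup>k\<^sup>-\<^sup>1/(k-1)!\<close>), so only the remainder contributes (\<open>one_step_error\<close>). On the interval the
  remainder is at most \<open>h\<^sup>p\<^sup>-\<^sup>1\<close> times the integral of \<open>\<parallel>f\<^sup>(\<^sup>p\<^sup>)\<parallel>\<close> over that interval
  (\<open>taylor_remainder_bound\<close>), and integrating or summing it over one step gains another factor \<open>h\<close>.
  The local errors then add up to \<open>h\<^sup>p\<close> times the integral over \<open>[0, t\<^sub>m]\<close>.

  The constant is \<open>sup \<parallel>S(t)\<parallel> + s sup \<parallel>b\<^sub>i\<parallel>\<close>, where the first supremum, over \<open>[0,T]\<close>, is finite by strong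
  continuity and the uniform boundedness principle (\<open>uniform_boundedness\<close>).
\<close>

section \<open>Strongly continuous operator families\<close>

text \<open>By Baire's theorem one of the closed sets \<open>V n\<close> of vectors whose orbit is bounded by \<open>n\<close>
  contains a ball; every vector is a multiple of a difference of two points of this ball.\<close>

lemma uniform_boundedness:
  fixes L :: "'i \<Rightarrow> 'a::banach \<Rightarrow>\<^sub>L 'b::real_normed_vector"
  assumes "\<And>v. \<exists>B. \<forall>i\<in>I. norm (L i v) \<le> B"
  obtains K where "\<And>i. i \<in> I \<Longrightarrow> norm (L i) \<le> K"
proof -
  define V where "V = (\<lambda>n::nat. {v. \<forall>i\<in>I. norm (L i v) \<le> real n})"
  have "\<not> (\<forall>n. interior (V n) = {})"
  proof
    assume empty: "\<forall>n. interior (V n) = {}"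
    have closed: "closed (V n)" for n
    proof -
      have "V n = (\<Inter>i\<in>I. {v. norm (L i v) \<le> real n})" by (auto simp: V_def)
      then show ?thesis by (auto intro!: closed_INT closed_Collect_le continuous_intros)
    qed
    have "(euclidean :: 'a topology) interior_of \<Union> (range V) = {}"
      using closed empty
      by (intro Baire_category_alt) (auto simp: completely_metrizable_space_euclidean)
    moreover have "\<Union> (range V) = UNIV"
    proof -
      have "\<exists>n. v \<in> V n" for v
      proof -
        obtain B where B: "\<forall>i\<in>I. norm (L i v) \<le> B" using assms by blast
        obtain n where "B \<le> real n" using real_arch_simple by blast
        with B show ?thesis
          by (intro exI[of _ n]) (auto simp: V_def intro: order_trans)
      qed
      then show ?thesis by blast
    qed
    ultimately show False by simp
  qed
  then obtain n x where "x \<in> interior (V n)" by blast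
  then obtain r where r: "0 < r" "cball x r \<subseteq> V n"
    by (meson mem_interior_cball)
  have "norm (L i) \<le> 2 * real n / r" if "i \<in> I" for i
  proof (rule norm_blinfun_bound)
    fix v
    show "norm (L i v) \<le> 2 * real n / r * norm v"
    proof (cases "v = 0")
      case False
      \<comment> \<open>\<open>y\<close> reaches from the centre to the boundary of the ball in the direction of \<open>v\<close>\<close>
      define y where "y = (r / norm v) *\<^sub>R v"
      have "x + y \<in> V n" "x \<in> V n"
        using r False by (auto simp: y_def dist_norm)
      then have "norm (L i (x + y)) \<le> n" "norm (L i x) \<le> n"
        using that by (auto simp: V_def)
      then have "norm (L i y) \<le> 2 * real n"
        using norm_triangle_ineq4[of "L i (x + y)" "L i x"] by (simp add: blinfun.add_right)
      moreover have "norm (L i y) = r / norm v * norm (L i v)"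
        using r by (simp add: y_def blinfun.scaleR_right)
      ultimately show ?thesis
        using r False by (simp add: field_simps)
    qed (simp add: blinfun.zero_right)
  qed (use r in simp)
  then show ?thesis by (rule that)
qed

text \<open>Strong continuity alone handles only a fixed vector. The uniform norm bound controls the
  effect of moving the vector as well:
  \<open>S(r z) (g z) = S(r z) (g y) + S(r z) (g z - g y)\<close>. This makes the integrand of the
  variation-of-constants formula continuous.\<close>

lemma continuous_on_strong_apply:
  fixes S :: "real \<Rightarrow> 'a::real_normed_vector \<Rightarrow>\<^sub>L 'b::real_normed_vector"
  assumes strong: "\<And>v. continuous_on X (\<lambda>t. S t v)"
    and bound: "\<And>t. t \<in> X \<Longrightarrow> norm (S t) \<le> K"
    and r: "continuous_on Y r" "r ` Y \<subseteq> X"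
    and g: "continuous_on Y g"
  shows "continuous_on Y (\<lambda>y. S (r y) (g y))"
  unfolding continuous_on_def
proof
  fix y assume y: "y \<in> Y"
  let ?F = "at y within Y"
  have "((\<lambda>z. S (r z) (g y)) \<longlongrightarrow> S (r y) (g y)) ?F"
    using continuous_on_compose2[OF strong r] y by (auto simp: continuous_on_def)
  moreover have "((\<lambda>z. S (r z) (g z - g y)) \<longlongrightarrow> 0) ?F"
  proof (rule Lim_null_comparison)
    show "\<forall>\<^sub>F z in ?F. norm (S (r z) (g z - g y)) \<le> K * norm (g z - g y)"
      unfolding eventually_at_filter
    proof (intro always_eventually allI impI)
      fix z assume "z \<in> Y"
      then have "norm (S (r z)) \<le> K" using r bound by blast
      then show "norm (S (r z) (g z - g y)) \<le> K * norm (g z - g y)"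
        by (meson mult_right_mono norm_blinfun norm_ge_zero order_trans)
    qed
    have "(g \<longlongrightarrow> g y) ?F" using g y by (auto simp: continuous_on_def)
    then have "((\<lambda>z. norm (g z - g y)) \<longlongrightarrow> 0) ?F"
      by (simp add: LIM_zero tendsto_norm_zero)
    then show "((\<lambda>z. K * norm (g z - g y)) \<longlongrightarrow> 0) ?F"
      by (rule tendsto_mult_right_zero)
  qed
  ultimately have "((\<lambda>z. S (r z) (g y) + S (r z) (g z - g y)) \<longlongrightarrow> S (r y) (g y) + 0) ?F"
    by (rule tendsto_add)
  then show "((\<lambda>z. S (r z) (g z)) \<longlongrightarrow> S (r y) (g y)) ?F"
    by (simp add: blinfun.diff_right)
qed

section \<open>Bochner integrals over intervals\<close>

lemma set_integrable_lebesgue_continuous: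
  fixes g :: "real \<Rightarrow> 'a::{banach,second_countable_topology}"
  assumes "continuous_on {a..b} g"
  shows "set_integrable lebesgue {a..b} g"
proof -
  have "integrable lborel (\<lambda>x. indicator {a..b} x *\<^sub>R g x)"
    using borel_integrable_atLeastAtMost'[OF assms] by (simp add: set_integrable_def)
  then show ?thesis
    unfolding set_integrable_def
    by (subst integrable_completion[OF borel_measurable_integrable])
qed

lemma set_integral_lebesgue_shift:
  fixes g :: "real \<Rightarrow> 'a::{banach,second_countable_topology}"
  assumes "continuous_on {a..a + h} g"
  shows "(LINT x:{a..a + h}|lebesgue. g x) = (LINT x:{0..h}|lebesgue. g (a + x))"
proof -
  have g': "continuous_on {0..h} (\<lambda>x. g (a + x))"
    by (intro continuous_on_compose2[OF assms] continuous_intros) auto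
  have "(LINT x:{a..a + h}|lebesgue. g x) = (\<integral>x. indicator {a..a + h} x *\<^sub>R g x \<partial>lborel)"
    unfolding set_lebesgue_integral_def
    using borel_integrable_atLeastAtMost'[OF assms, unfolded set_integrable_def]
    by (intro integral_completion) auto
  also have "\<dots> = (\<integral>x. indicator {a..a + h} (a + x) *\<^sub>R g (a + x) \<partial>lborel)"
    using lborel_integral_real_affine[of 1 "\<lambda>x. indicator {a..a + h} x *\<^sub>R g x" a] by simp
  also have "(\<lambda>x. indicator {a..a + h} (a + x) *\<^sub>R g (a + x)) = (\<lambda>x. indicator {0..h} x *\<^sub>R g (a + x))"
    by (auto simp: indicator_def)
  also have "integral\<^sup>L lborel \<dots> = (LINT x:{0..h}|lebesgue. g (a + x))"
    unfolding set_lebesgue_integral_def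
    using borel_integrable_atLeastAtMost'[OF g', unfolded set_integrable_def]
    by (intro integral_completion[symmetric]) auto
  finally show ?thesis .
qed

text \<open>The two pieces overlap only in the null set \<open>{b}\<close>.\<close>

lemma set_integral_Icc_combine:
  fixes g :: "real \<Rightarrow> 'a::{banach,second_countable_topology}"
  assumes "a \<le> b" "b \<le> c" "set_integrable lebesgue {a..c} g"
  shows "(LINT x:{a..c}|lebesgue. g x) = (LINT x:{a..b}|lebesgue. g x) + (LINT x:{b..c}|lebesgue. g x)"
proof -
  have "AE x in lebesgue. x \<noteq> b"
    by (rule AE_I[where N="{b}"]) auto
  then have "AE x in lebesgue. \<not> (x \<in> {a..b} \<and> x \<in> {b..c})"
    by eventually_elim auto
  then have "(LINT x:{a..b} \<union> {b..c}|lebesgue. g x) = (LINT x:{a..b}|lebesgue. g x) + (LINT x:{b..c}|lebesgue. g x)"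
    using assms by (intro set_integral_Un_AE set_integrable_subset[OF assms(3)]) auto
  moreover have "{a..b} \<union> {b..c} = {a..c}" using assms by auto
  ultimately show ?thesis by simp
qed

lemma set_integral_grid:
  fixes g :: "real \<Rightarrow> 'a::{banach,second_countable_topology}"
  assumes "0 \<le> h" "set_integrable lebesgue {0..real m * h} g"
  shows "(LINT x:{0..real m * h}|lebesgue. g x) =
    (\<Sum>j<m. LINT x:{real j * h..real j * h + h}|lebesgue. g x)"
  using assms(2)
proof (induction m)
  case 0
  have "(LINT x:{0..0}|lebesgue. g x) = 0"
    unfolding set_lebesgue_integral_def
    by (rule integral_eq_zero_AE, rule AE_I[where N="{0}"]) (auto simp: indicator_def)
  then show ?case by simp
next
  case (Suc m)
  have le: "real m * h \<le> real (Suc m) * h" using assms(1) by (simp add: algebra_simps)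
  have "set_integrable lebesgue {0..real m * h} g"
    using le by (intro set_integrable_subset[OF Suc.prems]) auto
  with Suc.IH have "(LINT x:{0..real m * h}|lebesgue. g x) =
    (\<Sum>j<m. LINT x:{real j * h..real j * h + h}|lebesgue. g x)" .
  moreover have "real (Suc m) * h = real m * h + h" by (simp add: algebra_simps)
  ultimately show ?case
    using set_integral_Icc_combine[of 0 "real m * h" "real (Suc m) * h" g] Suc.prems le assms(1) by simp
qed

lemma norm_set_integral_le_const:
  fixes g :: "real \<Rightarrow> 'a::{banach,second_countable_topology}"
  assumes "a \<le> b" "set_integrable lebesgue {a..b} g" "\<And>x. x \<in> {a..b} \<Longrightarrow> norm (g x) \<le> B"
  shows "norm (LINT x:{a..b}|lebesgue. g x) \<le> (b - a) * B"
proof -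
  have "norm (LINT x:{a..b}|lebesgue. g x) \<le> (LINT x:{a..b}|lebesgue. norm (g x))"
    by (rule set_integral_norm_bound[OF assms(2)])
  also have "\<dots> \<le> (LINT x:{a..b}|lebesgue. B)"
    using assms(3)
    by (intro set_integral_mono set_integrable_norm[OF assms(2)]
        set_integrable_lebesgue_continuous continuous_on_const)
  also have "\<dots> = (b - a) * B"
    using assms(1) by (simp add: set_integral_const)
  finally show ?thesis .
qed

lemma set_integral_taylor_monomial:
  fixes v :: "'a::{banach,second_countable_topology}"
  assumes "a \<le> t"
  shows "(LINT \<tau>:{a..t}|lebesgue. ((\<tau> - a) ^ j / fact j) *\<^sub>R v) = ((t - a) ^ Suc j / fact (Suc j)) *\<^sub>R v"
proof -
  have "((\<lambda>\<tau>. (\<tau> - a) ^ Suc j / fact (Suc j)) has_real_derivative (x - a) ^ j / fact j) (at x within {a..t})"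
    for x :: real
  proof -
    have "((\<lambda>\<tau>. (\<tau> - a) ^ Suc j / fact (Suc j)) has_real_derivative
        real (Suc j) * (x - a) ^ j / fact (Suc j)) (at x within {a..t})"
      by (auto intro!: derivative_eq_intros simp del: power_Suc fact_Suc)
    also have "real (Suc j) * (x - a) ^ j / fact (Suc j) = (x - a) ^ j / fact j"
      by (simp del: of_nat_Suc)
    finally show ?thesis .
  qed
  then have "((\<lambda>\<tau>. (\<tau> - a) ^ j / fact j) has_integral (t - a) ^ Suc j / fact (Suc j) - (a - a) ^ Suc j / fact (Suc j)) {a..t}"
    using assms
    by (intro fundamental_theorem_of_calculus)
       (auto simp: has_real_derivative_iff_has_vector_derivative simp del: power_Suc fact_Suc)
  moreover have int: "set_integrable lebesgue {a..t} (\<lambda>\<tau>. (\<tau> - a) ^ j / fact j)"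
    by (intro set_integrable_lebesgue_continuous continuous_intros) auto
  ultimately have "(LINT \<tau>:{a..t}|lebesgue. (\<tau> - a) ^ j / fact j) = (t - a) ^ Suc j / fact (Suc j)"
    using has_integral_unique[OF has_integral_set_lebesgue[OF int]] by simp
  moreover have "(LINT \<tau>:{a..t}|lebesgue. ((\<tau> - a) ^ j / fact j) *\<^sub>R v) = (LINT \<tau>:{a..t}|lebesgue. (\<tau> - a) ^ j / fact j) *\<^sub>R v"
    using int unfolding set_lebesgue_integral_def set_integrable_def
    by (subst integral_scaleR_left[symmetric]) (auto simp: mult.assoc)
  ultimately show ?thesis by simp
qed

lemma set_integrable_integral_sum:
  fixes g :: "'i \<Rightarrow> real \<Rightarrow> 'a::{banach,second_countable_topology}"
  assumes "\<And>i. i \<in> I \<Longrightarrow> set_integrable M X (g i)"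
  shows "set_integrable M X (\<lambda>x. \<Sum>i\<in>I. g i x)"
    and "(LINT x:X|M. \<Sum>i\<in>I. g i x) = (\<Sum>i\<in>I. LINT x:X|M. g i x)"
proof -
  have "integrable M (\<lambda>x. indicator X x *\<^sub>R g i x)" if "i \<in> I" for i
    using assms[OF that] by (simp add: set_integrable_def)
  then show "set_integrable M X (\<lambda>x. \<Sum>i\<in>I. g i x)"
    and "(LINT x:X|M. \<Sum>i\<in>I. g i x) = (\<Sum>i\<in>I. LINT x:X|M. g i x)"
    unfolding set_integrable_def set_lebesgue_integral_def scaleR_sum_right
    by (simp_all add: Bochner_Integration.integral_sum)
qed

section \<open>Taylor expansion with an integrable highest derivative\<close>

lemma L1_derivatives_increment:
  assumes "L1_derivatives T p f F" "k < p" "0 \<le> a" "a \<le> t" "t \<le> T"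
  shows "F k t = F k a + (LINT \<tau>:{a..t}|lebesgue. F (Suc k) \<tau>)"
proof -
  have int: "set_integrable lebesgue {0..T} (F (Suc k))"
    and F: "\<And>t. t \<in> {0..T} \<Longrightarrow> F k t = F k 0 + (LINT \<tau>:{0..t}|lebesgue. F (Suc k) \<tau>)"
    using assms(1,2) unfolding L1_derivatives_def by blast+
  have "set_integrable lebesgue {0..t} (F (Suc k))"
    using assms by (intro set_integrable_subset[OF int]) auto
  from set_integral_Icc_combine[OF assms(3,4) this] show ?thesis
    using F[of t] F[of a] assms(3-) by simp
qed

text \<open>Increments of \<open>F k\<close> are dominated by those of the indefinite integral \<open>\<Phi>\<close> of
  \<open>\<parallel>F (Suc k)\<parallel>\<close>. Passing to this real function gives access to the continuity of real indefinite
  integrals although \<open>F k\<close> itself takes values in a Banach space.\<close>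

lemma L1_derivatives_continuous:
  assumes "L1_derivatives T p f F" "k < p"
  shows "continuous_on {0..T} (F k)"
proof -
  let ?N = "\<lambda>\<tau>. norm (F (Suc k) \<tau>)"
  have "set_integrable lebesgue {0..T} (F (Suc k))"
    using assms unfolding L1_derivatives_def by blast
  then have N: "set_integrable lebesgue {0..T} ?N" and F: "set_integrable lebesgue {0..T} (F (Suc k))"
    by (auto intro: set_integrable_norm)
  define \<Phi> where "\<Phi> = (\<lambda>t. LINT \<tau>:{0..t}|lebesgue. ?N \<tau>)"
  have "continuous_on {0..T} (\<lambda>t. integral {0..t} ?N)"
    by (intro indefinite_integral_continuous_1 set_lebesgue_integral_eq_integral N)
  moreover have "integral {0..t} ?N = \<Phi> t" if "t \<in> {0..T}" for t
    unfolding \<Phi>_def using that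
    by (intro set_lebesgue_integral_eq_integral(2)[symmetric] set_integrable_subset[OF N]) auto
  ultimately have \<Phi>: "continuous_on {0..T} \<Phi>"
    by (rule continuous_on_eq)
  have mono: "norm (F k t - F k a) \<le> \<Phi> t - \<Phi> a" if "0 \<le> a" "a \<le> t" "t \<le> T" for a t
  proof -
    have "norm (F k t - F k a) = norm (LINT \<tau>:{a..t}|lebesgue. F (Suc k) \<tau>)"
      using L1_derivatives_increment[OF assms that] by simp
    also have "\<dots> \<le> (LINT \<tau>:{a..t}|lebesgue. ?N \<tau>)"
      using that by (intro set_integral_norm_bound set_integrable_subset[OF F]) auto
    also have "\<dots> = \<Phi> t - \<Phi> a"
      unfolding \<Phi>_def
      using that set_integral_Icc_combine[OF that(1,2) set_integrable_subset[OF N]] by auto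
    finally show ?thesis .
  qed
  have "dist (F k t) (F k a) \<le> dist (\<Phi> t) (\<Phi> a)" if "t \<in> {0..T}" "a \<in> {0..T}" for t a
    using mono[of a t] mono[of t a] that
    by (cases "a \<le> t") (auto simp: dist_norm norm_minus_commute)
  with \<Phi> show ?thesis
    unfolding continuous_on_iff by (meson order_le_less_trans)
qed

text \<open>Induction from the highest derivative downwards: the remainder of \<open>F (p - 1)\<close> is an
  increment, bounded by the integral of \<open>\<parallel>F p\<parallel>\<close>, and the remainder of each lower derivative is the
  integral of the remainder of the next one, over a length of at most \<open>h\<close>. Bounding each
  of these integrals by length times supremum costs only a factor \<open>n!\<close>, and not a power of \<open>h\<close>.\<close>

lemma taylor_remainder_bound:
  assumes L1: "L1_derivatives T p f F" and "n < p" "0 \<le> a" "0 \<le> h" "a + h \<le> T" and "\<sigma> \<in> {0..h}"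
  shows "norm (F (p - Suc n) (a + \<sigma>) - (\<Sum>j<Suc n. (\<sigma> ^ j / fact j) *\<^sub>R F (p - Suc n + j) a))
    \<le> h ^ n * (LINT \<tau>:{a..a + h}|lebesgue. norm (F p \<tau>))"
  using \<open>n < p\<close> \<open>\<sigma> \<in> {0..h}\<close>
proof (induction n arbitrary: \<sigma>)
  case 0
  define q where "q = p - Suc 0"
  have q: "Suc q = p" "q < p" using 0 by (auto simp: q_def)
  then have int: "set_integrable lebesgue {0..T} (F p)"
    using L1 unfolding L1_derivatives_def by metis
  have inth: "set_integrable lebesgue {a..a + h} (F p)"
    using assms by (intro set_integrable_subset[OF int]) auto
  have ints: "set_integrable lebesgue {a..a + \<sigma>} (F p)"
    using 0 assms by (intro set_integrable_subset[OF inth]) auto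
  have "norm (F q (a + \<sigma>) - F q a) = norm (LINT \<tau>:{a..a + \<sigma>}|lebesgue. F p \<tau>)"
    using L1_derivatives_increment[OF L1 q(2), of a "a + \<sigma>"] 0 assms(3-5) q by simp
  also have "\<dots> \<le> (LINT \<tau>:{a..a + \<sigma>}|lebesgue. norm (F p \<tau>))"
    by (rule set_integral_norm_bound[OF ints])
  also have "\<dots> \<le> (LINT \<tau>:{a..a + h}|lebesgue. norm (F p \<tau>))"
  proof -
    have "0 \<le> (LINT \<tau>:{a + \<sigma>..a + h}|lebesgue. norm (F p \<tau>))"
      unfolding set_lebesgue_integral_def by (intro integral_nonneg_AE) auto
    then show ?thesis
      using set_integral_Icc_combine[OF _ _ set_integrable_norm[OF inth], of "a + \<sigma>"] 0 by simp
  qed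
  finally show ?case by (simp add: q_def)
next
  case (Suc n)
  define q where "q = p - Suc (Suc n)"
  have q: "p - Suc n = Suc q" "q < p" "Suc q < p" using Suc.prems by (auto simp: q_def)
  let ?I = "LINT \<tau>:{a..a + h}|lebesgue. norm (F p \<tau>)"
  \<comment> \<open>the Taylor remainder of the next higher derivative\<close>
  define R where "R = (\<lambda>\<tau>. F (Suc q) \<tau> - (\<Sum>j<Suc n. ((\<tau> - a) ^ j / fact j) *\<^sub>R F (Suc q + j) a))"
  have intF: "set_integrable lebesgue {a..a + \<sigma>} (F (Suc q))"
    using assms Suc.prems L1_derivatives_continuous[OF L1 q(3)]
    by (intro set_integrable_lebesgue_continuous) (auto elim: continuous_on_subset)
  have intP: "set_integrable lebesgue {a..a + \<sigma>} (\<lambda>\<tau>. ((\<tau> - a) ^ j / fact j) *\<^sub>R F (Suc q + j) a)" for j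
    by (intro set_integrable_lebesgue_continuous continuous_intros) auto
  have "(LINT \<tau>:{a..a + \<sigma>}|lebesgue. R \<tau>) = (LINT \<tau>:{a..a + \<sigma>}|lebesgue. F (Suc q) \<tau>) -
      (\<Sum>j<Suc n. LINT \<tau>:{a..a + \<sigma>}|lebesgue. ((\<tau> - a) ^ j / fact j) *\<^sub>R F (Suc q + j) a)"
    unfolding R_def using intF intP
    by (simp only: set_integral_diff set_integrable_integral_sum)
  also have "\<dots> = F q (a + \<sigma>) - F q a - (\<Sum>j<Suc n. (\<sigma> ^ Suc j / fact (Suc j)) *\<^sub>R F (q + Suc j) a)"
    using L1_derivatives_increment[OF L1 q(2), of a "a + \<sigma>"] Suc.prems assms(3-5)
    by (simp add: set_integral_taylor_monomial del: fact_Suc power_Suc sum.lessThan_Suc)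
  also have "\<dots> = F q (a + \<sigma>) - (\<Sum>j<Suc (Suc n). (\<sigma> ^ j / fact j) *\<^sub>R F (q + j) a)"
    by (subst sum.lessThan_Suc_shift) simp
  finally have "F q (a + \<sigma>) - (\<Sum>j<Suc (Suc n). (\<sigma> ^ j / fact j) *\<^sub>R F (q + j) a) = (LINT \<tau>:{a..a + \<sigma>}|lebesgue. R \<tau>)"
    by simp
  moreover have "norm (LINT \<tau>:{a..a + \<sigma>}|lebesgue. R \<tau>) \<le> (a + \<sigma> - a) * (h ^ n * ?I)"
  proof (rule norm_set_integral_le_const)
    show "set_integrable lebesgue {a..a + \<sigma>} R"
      unfolding R_def by (intro set_integral_diff set_integrable_integral_sum intF intP)
    fix \<tau> assume "\<tau> \<in> {a..a + \<sigma>}"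
    then show "norm (R \<tau>) \<le> h ^ n * ?I"
      using Suc.IH[of "\<tau> - a"] Suc.prems unfolding R_def q by (simp del: sum.lessThan_Suc)
  qed (use Suc.prems in auto)
  moreover have "\<sigma> * (h ^ n * ?I) \<le> h * (h ^ n * ?I)"
  proof (intro mult_right_mono)
    have "0 \<le> ?I" unfolding set_lebesgue_integral_def by (intro integral_nonneg_AE) auto
    then show "0 \<le> h ^ n * ?I" using assms by auto
  qed (use Suc.prems in auto)
  ultimately show ?case unfolding q_def by (simp add: mult.assoc)
qed

section \<open>The quadrature error\<close>

text \<open>The order conditions make the quadrature exact for the polynomial with coefficients
  \<open>v j / j!\<close>, so \<open>g\<close> may be replaced by its distance from this polynomial both in the convolution
  and in the quadrature sum. Each is then bounded trivially by the operator norms.\<close>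

lemma one_step_error:
  fixes S :: "real \<Rightarrow> 'a::{real_inner,banach,second_countable_topology} \<Rightarrow>\<^sub>L 'a"
    and W :: "nat \<Rightarrow> 'a \<Rightarrow>\<^sub>L 'a"
  assumes "0 < h" "h \<le> t"
    and strong: "\<And>v. continuous_on {0..t} (\<lambda>r. S r v)"
    and KS: "\<And>r. r \<in> {0..t} \<Longrightarrow> norm (S r) \<le> KS"
    and KW: "\<And>i. i \<in> {1..s} \<Longrightarrow> norm (W i) \<le> KW"
    and c: "\<And>i. i \<in> {1..s} \<Longrightarrow> c i \<in> {0..1}"
    and order: "\<And>k v. k \<in> {1..p} \<Longrightarrow>
      (\<Sum>i=1..s. (c i ^ (k - 1) / fact (k - 1)) *\<^sub>R W i v) = phi S k h t v"
    and g: "continuous_on {0..h} g"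
    and remainder: "\<And>\<sigma>. \<sigma> \<in> {0..h} \<Longrightarrow> norm (g \<sigma> - (\<Sum>j<p. (\<sigma> ^ j / fact j) *\<^sub>R v j)) \<le> \<rho>"
  shows "norm ((LINT \<sigma>:{0..h}|lebesgue. S (t - \<sigma>) (g \<sigma>)) - h *\<^sub>R (\<Sum>i=1..s. W i (g (c i * h))))
    \<le> h * (KS + real s * KW) * \<rho>"
proof -
  define P where "P = (\<lambda>\<sigma>. \<Sum>j<p. (\<sigma> ^ j / fact j) *\<^sub>R v j)"
  have int: "set_integrable lebesgue {0..h} (\<lambda>\<sigma>. S (t - \<sigma>) (q \<sigma>))"
    if "continuous_on {0..h} q" for q
  proof (rule set_integrable_lebesgue_continuous, rule continuous_on_strong_apply[OF strong KS])
    show "continuous_on {0..h} (\<lambda>\<sigma>. t - \<sigma>)" by (intro continuous_intros)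
  qed (use assms(1,2) that in auto)
  have P: "continuous_on {0..h} P"
    unfolding P_def by (intro continuous_intros) auto
  have mono: "set_integrable lebesgue {0..h} (\<lambda>\<sigma>. (\<sigma> ^ j / fact j) *\<^sub>R S (t - \<sigma>) (v j))" for j
  proof -
    have "continuous_on {0..h} (\<lambda>\<sigma>. (\<sigma> ^ j / fact j) *\<^sub>R v j)"
      by (intro continuous_intros) auto
    from int[OF this] show ?thesis by (simp add: blinfun.scaleR_right)
  qed
  have "(LINT \<sigma>:{0..h}|lebesgue. S (t - \<sigma>) (P \<sigma>)) =
      (\<Sum>j<p. LINT \<sigma>:{0..h}|lebesgue. (\<sigma> ^ j / fact j) *\<^sub>R S (t - \<sigma>) (v j))"
    unfolding P_def blinfun.sum_right blinfun.scaleR_right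
    by (intro set_integrable_integral_sum mono)
  also have "\<dots> = (\<Sum>j<p. h ^ Suc j *\<^sub>R phi S (Suc j) h t (v j))"
    using assms(1) by (simp add: phi_def)
  also have "\<dots> = (\<Sum>j<p. h ^ Suc j *\<^sub>R (\<Sum>i=1..s. (c i ^ j / fact j) *\<^sub>R W i (v j)))"
    using order[of "Suc _"] by (intro sum.cong) auto
  also have "\<dots> = h *\<^sub>R (\<Sum>i=1..s. W i (P (c i * h)))"
    unfolding P_def blinfun.sum_right blinfun.scaleR_right scaleR_sum_right
    by (subst sum.swap) (simp add: power_mult_distrib mult_ac)
  finally have exact: "(LINT \<sigma>:{0..h}|lebesgue. S (t - \<sigma>) (P \<sigma>)) = h *\<^sub>R (\<Sum>i=1..s. W i (P (c i * h)))" .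
  have "(LINT \<sigma>:{0..h}|lebesgue. S (t - \<sigma>) (g \<sigma> - P \<sigma>)) =
      (LINT \<sigma>:{0..h}|lebesgue. S (t - \<sigma>) (g \<sigma>)) - (LINT \<sigma>:{0..h}|lebesgue. S (t - \<sigma>) (P \<sigma>))"
    unfolding blinfun.diff_right by (intro set_integral_diff int g P)
  with exact have split: "(LINT \<sigma>:{0..h}|lebesgue. S (t - \<sigma>) (g \<sigma>)) - h *\<^sub>R (\<Sum>i=1..s. W i (g (c i * h))) =
      (LINT \<sigma>:{0..h}|lebesgue. S (t - \<sigma>) (g \<sigma> - P \<sigma>)) - h *\<^sub>R (\<Sum>i=1..s. W i (g (c i * h) - P (c i * h)))"
    by (simp add: blinfun.diff_right sum_subtractf algebra_simps)
  have convolution: "norm (LINT \<sigma>:{0..h}|lebesgue. S (t - \<sigma>) (g \<sigma> - P \<sigma>)) \<le> (h - 0) * (KS * \<rho>)"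
  proof (intro norm_set_integral_le_const int continuous_on_diff g P)
    fix \<sigma> assume \<sigma>: "\<sigma> \<in> {0..h}"
    have "norm (S (t - \<sigma>) (g \<sigma> - P \<sigma>)) \<le> norm (S (t - \<sigma>)) * norm (g \<sigma> - P \<sigma>)"
      by (rule norm_blinfun)
    also have "\<dots> \<le> KS * \<rho>"
    proof (rule mult_mono)
      show "norm (S (t - \<sigma>)) \<le> KS" using \<sigma> assms(1,2) by (intro KS) auto
      then show "0 \<le> KS" by (rule order_trans[OF norm_ge_zero])
      show "norm (g \<sigma> - P \<sigma>) \<le> \<rho>" unfolding P_def by (rule remainder[OF \<sigma>])
    qed simp
    finally show "norm (S (t - \<sigma>) (g \<sigma> - P \<sigma>)) \<le> KS * \<rho>" .
  qed (use assms(1) in auto)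
  have "norm (\<Sum>i=1..s. W i (g (c i * h) - P (c i * h))) \<le> real s * (KW * \<rho>)"
  proof -
    have "norm (W i (g (c i * h) - P (c i * h))) \<le> KW * \<rho>" if i: "i \<in> {1..s}" for i
    proof -
      have ch: "c i * h \<in> {0..h}"
        using c[OF i] assms(1) by (auto simp: mult_left_le_one_le)
      have "norm (W i (g (c i * h) - P (c i * h))) \<le> norm (W i) * norm (g (c i * h) - P (c i * h))"
        by (rule norm_blinfun)
      also have "\<dots> \<le> KW * \<rho>"
      proof (rule mult_mono)
        show "norm (W i) \<le> KW" by (rule KW[OF i])
        then show "0 \<le> KW" by (rule order_trans[OF norm_ge_zero])
        show "norm (g (c i * h) - P (c i * h)) \<le> \<rho>" unfolding P_def by (rule remainder[OF ch])
      qed simp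
      finally show ?thesis .
    qed
    then show ?thesis
      using sum_norm_bound[of "{1..s}" "\<lambda>i. W i (g (c i * h) - P (c i * h))" "KW * \<rho>"] by simp
  qed
  then have quadrature: "norm (h *\<^sub>R (\<Sum>i=1..s. W i (g (c i * h) - P (c i * h)))) \<le> h * (real s * (KW * \<rho>))"
    using assms(1) by (simp add: mult_left_mono)
  show ?thesis
    unfolding split using order_trans[OF norm_triangle_ineq4 add_mono[OF convolution quadrature]]
    by (simp add: algebra_simps)
qed

theorem theorem3p2:
  fixes D :: "'a::{real_inner,banach,second_countable_topology} set"
    and A :: "'a \<Rightarrow> 'a"
    and \<psi> :: "nat \<Rightarrow> 'a" and ev :: "nat \<Rightarrow> real"
    and b :: "real \<Rightarrow> real"
    and S :: "real \<Rightarrow> 'a \<Rightarrow>\<^sub>L 'a"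
    and T :: real
    and s p :: nat and c :: "nat \<Rightarrow> real"
    and w :: "real \<Rightarrow> nat \<Rightarrow> real \<Rightarrow> 'a \<Rightarrow>\<^sub>L 'a"
  assumes "self_adjoint_op D A"
    and "positive_definite_op D A"
    and "has_compact_inverse D A"
    and "eigenbasis D A \<psi> ev"
    and "positive_definite_kernel b"
    and "resolvent_family D A b S"
    and "T > 0"
    and "smoothing_assumption \<psi> ev T S"
    and "p \<ge> 1"
    and "quadrature_nodes s c"
    and "weights_uniformly_bounded T s w"
    and "has_order S T s c w p"
  shows "\<exists>C. \<forall>u0 f F. L1_derivatives T p f F \<longrightarrow>
           (\<forall>M\<ge>1. \<forall>m\<le>M. let h = T / real M in
              norm (voc_solution S u0 f (real m * h) - exp_quadrature S s c w u0 f h m)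
                \<le> C * h ^ p * (LINT \<tau>:{0..real m * h}|lebesgue. norm (F p \<tau>)))"
proof -
  have strong: "continuous_on {0..} (\<lambda>t. S t v)" for v
    using assms(6) unfolding resolvent_family_def by blast
  have orbits: "\<exists>B. \<forall>t\<in>{0..T}. norm (S t v) \<le> B" for v
  proof -
    have "compact ((\<lambda>t. S t v) ` {0..T})"
      by (rule compact_continuous_image[OF continuous_on_subset[OF strong]]) auto
    then show ?thesis
      by (auto simp: bounded_iff dest!: compact_imp_bounded)
  qed
  obtain KS where KS: "\<And>t. t \<in> {0..T} \<Longrightarrow> norm (S t) \<le> KS"
    using uniform_boundedness[of "{0..T}" S, OF orbits] by metis
  obtain KW where KW: "\<And>M i l. \<lbrakk>M \<ge> 1; i \<in> {1..s}; l \<in> {1..M}\<rbrakk> \<Longrightarrow>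
      norm (w (T / real M) i (real l * (T / real M))) \<le> KW"
    using assms(11) unfolding weights_uniformly_bounded_def by blast
  \<comment> \<open>the nodes stay inside the step, where the Taylor bound applies\<close>
  have c: "c i \<in> {0..1}" if "i \<in> {1..s}" for i
  proof -
    have "mono_on {1..s} c" "c 1 = 0" "c s \<le> 1" "1 \<le> s"
      using assms(10) unfolding quadrature_nodes_def by (auto intro: strict_mono_on_imp_mono_on)
    then have "c 1 \<le> c i" "c i \<le> c s"
      using that mono_onD[of "{1..s}" c 1 i] mono_onD[of "{1..s}" c i s] by simp_all
    with \<open>c 1 = 0\<close> \<open>c s \<le> 1\<close> show ?thesis by simp
  qed
  show ?thesis
  proof (intro exI allI impI)
    fix u0 :: 'a and f :: "real \<Rightarrow> 'a" and F and M m :: nat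
    assume L1: "L1_derivatives T p f F" and M: "1 \<le> M" and m: "m \<le> M"
    define h where "h = T / real M"
    have h: "0 < h" using assms(7) M by (simp add: h_def)
    have T: "T = real M * h" using M by (simp add: h_def)
    have gridT: "real j * h \<le> T" if "j \<le> M" for j
      using that h by (simp add: T)
    define t where "t = real m * h"
    have t: "t \<le> T" unfolding t_def by (rule gridT[OF m])
    have f: "f r = F 0 r" if "r \<in> {0..T}" for r
      using L1 that unfolding L1_derivatives_def by simp
    have F0: "continuous_on {0..T} (F 0)"
      using L1_derivatives_continuous[OF L1] assms(9) by simp
    have conv_cont: "continuous_on {0..t} (\<lambda>\<sigma>. S (t - \<sigma>) (F 0 \<sigma>))"
    proof (rule continuous_on_strong_apply[where X = "{0..T}", OF _ KS])
      show "continuous_on {0..T} (\<lambda>r. S r v)" for v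
        by (rule continuous_on_subset[OF strong]) auto
      show "continuous_on {0..t} (\<lambda>\<sigma>. t - \<sigma>)" by (intro continuous_intros)
      show "continuous_on {0..t} (F 0)" using t by (intro continuous_on_subset[OF F0]) auto
    qed (use t in auto)
    let ?conv = "\<lambda>j. LINT \<sigma>:{0..h}|lebesgue. S (real (m - j) * h - \<sigma>) (F 0 (real j * h + \<sigma>))"
    let ?quad = "\<lambda>j. h *\<^sub>R (\<Sum>i=1..s. w h i (real (m - j) * h) (F 0 (real j * h + c i * h)))"
    let ?I = "\<lambda>j. LINT \<tau>:{real j * h..real j * h + h}|lebesgue. norm (F p \<tau>)"
    have jm: "real j * h + h \<le> t" if "j < m" for j
    proof -
      have "real (Suc j) * h \<le> real m * h"
        using that h by (intro mult_right_mono) auto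
      then show ?thesis by (simp add: t_def algebra_simps)
    qed
    have "(LINT \<sigma>:{0..t}|lebesgue. S (t - \<sigma>) (f \<sigma>)) = (LINT \<sigma>:{0..t}|lebesgue. S (t - \<sigma>) (F 0 \<sigma>))"
      using f t by (intro set_lebesgue_integral_cong) auto
    also have "\<dots> = (\<Sum>j<m. LINT \<sigma>:{real j * h..real j * h + h}|lebesgue. S (t - \<sigma>) (F 0 \<sigma>))"
      using h set_integrable_lebesgue_continuous[OF conv_cont] unfolding t_def
      by (intro set_integral_grid) auto
    also have "\<dots> = (\<Sum>j<m. ?conv j)"
    proof (intro sum.cong refl)
      fix j assume "j \<in> {..<m}"
      then have "continuous_on {real j * h..real j * h + h} (\<lambda>\<sigma>. S (t - \<sigma>) (F 0 \<sigma>))"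
        using jm[of j] h by (intro continuous_on_subset[OF conv_cont]) auto
      note set_integral_lebesgue_shift[OF this]
      moreover have "t - (real j * h + \<sigma>) = real (m - j) * h - \<sigma>" for \<sigma>
        using \<open>j \<in> {..<m}\<close> by (simp add: t_def of_nat_diff algebra_simps)
      ultimately show "(LINT \<sigma>:{real j * h..real j * h + h}|lebesgue. S (t - \<sigma>) (F 0 \<sigma>)) = ?conv j"
        by simp
    qed
    finally have voc: "voc_solution S u0 f t = S t u0 + (\<Sum>j<m. ?conv j)"
      unfolding voc_solution_def by simp
    have node: "f (real j * h + c i * h) = F 0 (real j * h + c i * h)" if "j < m" "i \<in> {1..s}" for i j
    proof (rule f)
      have "0 \<le> c i * h" "c i * h \<le> h" using c[OF that(2)] h by (auto simp: mult_left_le_one_le)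
      moreover have "0 \<le> real j * h" using h by simp
      ultimately show "real j * h + c i * h \<in> {0..T}"
        using jm[OF that(1)] t unfolding atLeastAtMost_iff by linarith
    qed
    have "exp_quadrature S s c w u0 f h m = S t u0 + (\<Sum>j<m. ?quad j)"
      unfolding exp_quadrature_def t_def scaleR_sum_right using node by simp
    with voc have "norm (voc_solution S u0 f t - exp_quadrature S s c w u0 f h m) =
        norm (\<Sum>j<m. ?conv j - ?quad j)"
      by (simp add: sum_subtractf)
    also have "\<dots> \<le> (\<Sum>j<m. norm (?conv j - ?quad j))"
      by (rule norm_sum)
    also have "\<dots> \<le> (\<Sum>j<m. (KS + real s * KW) * h ^ p * ?I j)"
    proof (rule sum_mono)
      fix j assume "j \<in> {..<m}"
      then have j: "j < m" and l: "m - j \<in> {1..M}" using m by auto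
      have "norm (?conv j - ?quad j) \<le> h * (KS + real s * KW) * (h ^ (p - 1) * ?I j)"
      proof (rule one_step_error[where p = p and v = "\<lambda>k. F k (real j * h)"])
        have "1 * h \<le> real (m - j) * h" using l h by (intro mult_right_mono) auto
        then show "h \<le> real (m - j) * h" by simp
        have le: "real (m - j) * h \<le> T" using l by (intro gridT) auto
        show "continuous_on {0..real (m - j) * h} (\<lambda>r. S r v)" for v
          by (rule continuous_on_subset[OF strong]) auto
        show "norm (S r) \<le> KS" if "r \<in> {0..real (m - j) * h}" for r
          using that le by (intro KS) auto
        show "norm (w h i (real (m - j) * h)) \<le> KW" if "i \<in> {1..s}" for i
          using KW[OF M that l] by (simp add: h_def)
        show "(\<Sum>i=1..s. (c i ^ (k - 1) / fact (k - 1)) *\<^sub>R w h i (real (m - j) * h) v) =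
            phi S k h (real (m - j) * h) v" if "k \<in> {1..p}" for k v
          using assms(12) M l that unfolding has_order_def Let_def h_def by blast
        show "continuous_on {0..h} (\<lambda>\<sigma>. F 0 (real j * h + \<sigma>))"
          using jm[OF j] t h by (intro continuous_on_compose2[OF F0] continuous_intros) auto
        show "norm (F 0 (real j * h + \<sigma>) - (\<Sum>k<p. (\<sigma> ^ k / fact k) *\<^sub>R F k (real j * h)))
            \<le> h ^ (p - 1) * ?I j" if "\<sigma> \<in> {0..h}" for \<sigma>
          using taylor_remainder_bound[OF L1, of "p - 1" "real j * h" h \<sigma>] that jm[OF j] t h assms(9)
          by simp
      qed (use h c in auto)
      also have "\<dots> = (KS + real s * KW) * (h * h ^ (p - 1)) * ?I j" by simp
      also have "h * h ^ (p - 1) = h ^ p" using assms(9) by (simp add: power_eq_if)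
      finally show "norm (?conv j - ?quad j) \<le> (KS + real s * KW) * h ^ p * ?I j" .
    qed
    also have "\<dots> = (KS + real s * KW) * h ^ p * (\<Sum>j<m. ?I j)"
      by (simp add: sum_distrib_left)
    also have "(\<Sum>j<m. ?I j) = (LINT \<tau>:{0..real m * h}|lebesgue. norm (F p \<tau>))"
    proof (rule set_integral_grid[symmetric])
      have "p - 1 < p" "Suc (p - 1) = p" using assms(9) by auto
      then have "set_integrable lebesgue {0..T} (F p)"
        using L1 unfolding L1_derivatives_def by metis
      then show "set_integrable lebesgue {0..real m * h} (\<lambda>\<tau>. norm (F p \<tau>))"
        using t unfolding t_def by (intro set_integrable_norm) (auto elim: set_integrable_subset)
    qed (use h in simp)
    finally show "let h = T / real M in
        norm (voc_solution S u0 f (real m * h) - exp_quadrature S s c w u0 f h m)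
          \<le> (KS + real s * KW) * h ^ p * (LINT \<tau>:{0..real m * h}|lebesgue. norm (F p \<tau>))"
      unfolding Let_def t_def h_def by simp
  qed
qed

end
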